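(* Let $(X_n)_{0\le n\le N-1}$ be a (possibly time-inhomogeneous) Markov chain on a finite state space $\mathbb{S}$ with transition matrices $P(n)=(P_{ij}(n))_{i,j\in\mathbb{S}}$, $n\in\{0,\dots,N-2\}$, and initial distribution $\lambda(0)$. Then the forward committor satisfies, for $n\in\{0,\dots,N-2\}$, $$\begin{cases} q_i^+(n)=\sum_{j\in\mathbb{S}}P_{ij}(n)\,q_j^+(n+1)& i\in C,\\ q_i^+(n)=0& i\in A,\\ q_i^+(n)=1& i\in B,\end{cases}$$ with final condition $q_i^+(N-1)=\mathbf{1}_B(i)$ for $i\in\mathbb{S}$. Analogously, the backward committor satisfies, for $n\in\{1,\dots,N-1\}$, $$\begin{cases} q_i^-(n)=\sum_{j\in\mathbb{S}}P^-_{ij}(n)\,q_j^-(n-1)& i\in C,\\ q_i^-(n)=1& i\in A,\\ q_i^-(n)=0& i\in B,\end{cases}$$ with initial condition $q_i^-(0)=\mathbf{1}_A(i)$ for $i\in\mathbb{S}$.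
   Context: $A,B\subset\mathbb{S}$ are non-empty disjoint subsets of the finite state space $\mathbb{S}$ with $C:=(A\cup B)^c$ non-empty. $N\in\mathbb{N}$ and $\mathbb{T}=\{0,\dots,N-1\}$. The matrices $P(n)$ are row-stochastic with $P_{ij}(n)=\mathbb{P}(X_{n+1}=j\mid X_n=i)$. The distributions are $\lambda_i(n)=\mathbb{P}(X_n=i)$, with $\lambda(n+1)^\top=\lambda(n)^\top P(n)$. Backward transition probabilities for $n\in\{1,\dots,N-1\}$: $P^-_{ij}(n):=\mathbb{P}(X_{n-1}=j\mid X_n=i)=\frac{\lambda_j(n-1)}{\lambda_i(n)}P_{ji}(n-1)$ whenever $\lambda_i(n)>0$; by convention $P^-_{ij}(n):=0$ if $\lambda_i(n)=0$. For $S\subset\mathbb{S}$ and $n\in\mathbb{T}$: $\tau_S^+(n):=\inf\{k\in\mathbb{T}: k\ge n, X_k\in S\}$ ($\inf\emptyset:=\infty$), $\tau_S^-(n):=\sup\{k\in\mathbb{T}: k\le n, X_k\in S\}$ ($\sup\emptyset:=-\infty$). Committors: $q_i^+(n):=\mathbb{P}(\tau_B^+(n)<\tau_A^+(n)\mid X_n=i)$ and $q_i^-(n):=\mathbb{P}(\tau_A^-(n)>\tau_B^-(n)\mid X_n=i)$. Convention for states with $\lambda_i(n)=0$: $q_i^+(n)$ is the probability of $\{\tau_B^+(n)<\tau_A^+(n)\}$ for the chain with the given transition matrices started at time $n$ in $i$; $q_i^-(n)$ is set to $1$ if $i\in A$ and to $0$ otherwise. *)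

theory Defs
  imports "HOL-Probability.Probability"
begin

text \<open>Chains live on a finite state type and on the time set \<open>{..<N}\<close>; the values of
  \<open>P k\<close> for \<open>Suc k \<ge> N\<close> and of \<open>X k\<close> for \<open>k \<ge> N\<close> never matter.\<close>

definition row_stochastic :: "('s::finite \<Rightarrow> 's \<Rightarrow> real) \<Rightarrow> bool" where
  "row_stochastic Q \<longleftrightarrow> (\<forall>i j. 0 \<le> Q i j) \<and> (\<forall>i. (\<Sum>j\<in>UNIV. Q i j) = 1)"

text \<open>The Markov property is imposed for histories of positive probability only, so the rows of
  \<open>P n\<close> belonging to states that are not visited at time \<open>n\<close> are arbitrary
  probability vectors.\<close>

definition markov_chain ::
  "'w measure \<Rightarrow> nat \<Rightarrow> (nat \<Rightarrow> 's \<Rightarrow> 's \<Rightarrow> real) \<Rightarrow> ('s \<Rightarrow> real) \<Rightarrow> (nat \<Rightarrow> 'w \<Rightarrow> 's::finite) \<Rightarrow> bool" where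
  "markov_chain M N P \<mu> X \<longleftrightarrow>
     prob_space M \<and>
     (\<forall>n<N. X n \<in> measurable M (count_space UNIV)) \<and>
     (\<forall>i. \<P>(\<omega> in M. X 0 \<omega> = i) = \<mu> i) \<and>
     (\<forall>n. Suc n < N \<longrightarrow> row_stochastic (P n)) \<and>
     (\<forall>n x. Suc n < N \<longrightarrow> \<P>(\<omega> in M. \<forall>k\<le>n. X k \<omega> = x k) > 0 \<longrightarrow>
        \<P>(\<omega> in M. X (Suc n) \<omega> = x (Suc n) \<bar> \<forall>k\<le>n. X k \<omega> = x k) = P n (x n) (x (Suc n)))"

definition state_prob :: "'w measure \<Rightarrow> (nat \<Rightarrow> 'w \<Rightarrow> 's) \<Rightarrow> nat \<Rightarrow> 's \<Rightarrow> real" where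
  "state_prob M X n i = \<P>(\<omega> in M. X n \<omega> = i)"

definition backward_trans :: "'w measure \<Rightarrow> (nat \<Rightarrow> 'w \<Rightarrow> 's) \<Rightarrow> nat \<Rightarrow> 's \<Rightarrow> 's \<Rightarrow> real" where
  "backward_trans M X n i j =
     (if state_prob M X n i > 0 then \<P>(\<omega> in M. X (n - 1) \<omega> = j \<bar> X n \<omega> = i) else 0)"

text \<open>Visit times are extended reals, so that \<open>Inf {} = \<infinity>\<close> and
  \<open>Sup {} = - \<infinity>\<close>.\<close>

definition first_visit :: "nat \<Rightarrow> 's set \<Rightarrow> nat \<Rightarrow> (nat \<Rightarrow> 's) \<Rightarrow> ereal" where
  "first_visit N S n x = Inf ((\<lambda>k. ereal (real k)) ` {k. k < N \<and> n \<le> k \<and> x k \<in> S})"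

definition last_visit :: "nat \<Rightarrow> 's set \<Rightarrow> nat \<Rightarrow> (nat \<Rightarrow> 's) \<Rightarrow> ereal" where
  "last_visit N S n x = Sup ((\<lambda>k. ereal (real k)) ` {k. k < N \<and> k \<le> n \<and> x k \<in> S})"

text \<open>Path law, on times \<open>n, \<dots>, N - 1\<close>, of the chain with transition matrices
  \<open>P\<close> started at time \<open>n\<close> in the state \<open>i\<close>.\<close>

definition started_chain ::
  "nat \<Rightarrow> (nat \<Rightarrow> 's \<Rightarrow> 's \<Rightarrow> real) \<Rightarrow> nat \<Rightarrow> 's::finite \<Rightarrow> (nat \<Rightarrow> 's) measure" where
  "started_chain N P n i =
     point_measure {x \<in> {n..<N} \<rightarrow>\<^sub>E UNIV. x n = i}
       (\<lambda>x. ennreal (\<Prod>k\<in>{n..<N-1}. P k (x k) (x (Suc k))))"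

definition forward_committor ::
  "'w measure \<Rightarrow> nat \<Rightarrow> (nat \<Rightarrow> 's \<Rightarrow> 's \<Rightarrow> real) \<Rightarrow> (nat \<Rightarrow> 'w \<Rightarrow> 's::finite)
     \<Rightarrow> 's set \<Rightarrow> 's set \<Rightarrow> nat \<Rightarrow> 's \<Rightarrow> real" where
  "forward_committor M N P X A B n i =
     (if state_prob M X n i > 0 then
        \<P>(\<omega> in M. first_visit N B n (\<lambda>k. X k \<omega>) < first_visit N A n (\<lambda>k. X k \<omega>) \<bar> X n \<omega> = i)
      else
        \<P>(x in started_chain N P n i. first_visit N B n x < first_visit N A n x))"

definition backward_committor ::
  "'w measure \<Rightarrow> nat \<Rightarrow> (nat \<Rightarrow> 'w \<Rightarrow> 's) \<Rightarrow> 's set \<Rightarrow> 's set \<Rightarrow> nat \<Rightarrow> 's \<Rightarrow> real" where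
  "backward_committor M N X A B n i =
     (if state_prob M X n i > 0 then
        \<P>(\<omega> in M. last_visit N A n (\<lambda>k. X k \<omega>) > last_visit N B n (\<lambda>k. X k \<omega>) \<bar> X n \<omega> = i)
      else if i \<in> A then 1 else 0)"

end

theory Submission
  imports Defs
begin

text \<open>The committor equations are first-step analysis in both time directions.

  Forward: whether \<open>B\<close> is reached before \<open>A\<close> is a property of the path from time
  \<open>n\<close> on, and from a state of \<open>C\<close> it is the same property of the path from time
  \<open>Suc n\<close> on. The difficulty is the case distinction in the committor: a state
  \<open>i\<close> of probability zero at time \<open>n\<close> may lead to states of positive probability at time
  \<open>Suc n\<close>, so the two branches of the definition meet in one equation. They are unified by
  \<open>forward_committor_eq_path_sum\<close>: by the Markov property, both are the sum of the transition
  weights \<open>\<Prod>k. P k (x k) (x (Suc k))\<close> over the paths \<open>x\<close> that start in \<open>i\<close> and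
  reach \<open>B\<close> first. The recursion is then the finite identity \<open>path_sum_step\<close>, which
  factors the first transition out of the weights.

  Backward: \<open>A\<close> being visited more recently than \<open>B\<close> is a property of the past. Given
  \<open>X (n - 1) = j\<close>, the past is independent of \<open>X n\<close> (\<open>prob_past_next\<close>),
  so conditioning on \<open>X (n - 1)\<close> gives the recursion. Here the convention for states of
  probability zero never enters a sum: all backward transition probabilities from or into such a
  state vanish.

  On \<open>A \<union> B\<close> the outcome is decided at time \<open>n\<close> itself, and outside
  \<open>A \<union> B\<close> at the last (first) time nothing remains to be visited.\<close>

section \<open>Visits before and after a given time\<close>

text \<open>Events such as \<open>first_visit N B n x < first_visit N A n x\<close> are treated as predicates
  on whole sequences; the time window that decides them is what the Markov property needs.\<close>

definition depends_on :: "nat set \<Rightarrow> ((nat \<Rightarrow> 's) \<Rightarrow> bool) \<Rightarrow> bool" where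
  "depends_on I F \<longleftrightarrow> (\<forall>x y. (\<forall>k\<in>I. x k = y k) \<longrightarrow> F x = F y)"

lemma depends_onD: "depends_on I F \<Longrightarrow> (\<And>k. k \<in> I \<Longrightarrow> x k = y k) \<Longrightarrow> F x = F y"
  unfolding depends_on_def by blast

lemma first_visit_cong:
  assumes "\<And>k. k \<in> {n..<N} \<Longrightarrow> x k = y k"
  shows "first_visit N S n x = first_visit N S n y"
proof -
  have "{k. k < N \<and> n \<le> k \<and> x k \<in> S} = {k. k < N \<and> n \<le> k \<and> y k \<in> S}"
    using assms by auto
  then show ?thesis unfolding first_visit_def by simp
qed

lemma last_visit_cong:
  assumes "\<And>k. k \<in> {..n} \<Longrightarrow> x k = y k"
  shows "last_visit N S n x = last_visit N S n y"
proof -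
  have "{k. k < N \<and> k \<le> n \<and> x k \<in> S} = {k. k < N \<and> k \<le> n \<and> y k \<in> S}"
    using assms by auto
  then show ?thesis unfolding last_visit_def by simp
qed

lemma depends_on_first_visit:
  "depends_on {n..<N} (\<lambda>x. first_visit N B n x < first_visit N A n x)"
  unfolding depends_on_def by (metis first_visit_cong)

lemma depends_on_last_visit:
  "depends_on {..n} (\<lambda>x. last_visit N B n x < last_visit N A n x)"
  unfolding depends_on_def by (metis last_visit_cong)

lemma first_visit_ge: "ereal (real n) \<le> first_visit N S n x"
  unfolding first_visit_def by (rule Inf_greatest) auto

lemma last_visit_le: "last_visit N S n x \<le> ereal (real n)"
  unfolding last_visit_def by (rule Sup_least) auto

lemma first_visit_now:
  assumes "n < N" "x n \<in> S"
  shows "first_visit N S n x = ereal (real n)"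
proof (rule antisym[OF _ first_visit_ge])
  show "first_visit N S n x \<le> ereal (real n)"
    unfolding first_visit_def by (rule Inf_lower) (use assms in auto)
qed

lemma last_visit_now:
  assumes "n < N" "x n \<in> S"
  shows "last_visit N S n x = ereal (real n)"
proof (rule antisym[OF last_visit_le])
  show "ereal (real n) \<le> last_visit N S n x"
    unfolding last_visit_def by (rule Sup_upper) (use assms in auto)
qed

lemma first_visit_later:
  assumes "x n \<notin> S"
  shows "first_visit N S n x = first_visit N S (Suc n) x"
proof -
  have "{k. k < N \<and> n \<le> k \<and> x k \<in> S} = {k. k < N \<and> Suc n \<le> k \<and> x k \<in> S}"
    using assms by (auto simp: Suc_le_eq order.order_iff_strict)
  then show ?thesis unfolding first_visit_def by simp
qed

lemma last_visit_earlier: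
  assumes "x (Suc n) \<notin> S"
  shows "last_visit N S (Suc n) x = last_visit N S n x"
proof -
  have "{k. k < N \<and> k \<le> Suc n \<and> x k \<in> S} = {k. k < N \<and> k \<le> n \<and> x k \<in> S}"
    using assms by (auto simp: le_Suc_eq)
  then show ?thesis unfolding last_visit_def by simp
qed

lemma first_visit_none: "first_visit N S N x = \<infinity>"
proof -
  have *: "{k. k < N \<and> N \<le> k \<and> x k \<in> S} = {}" by auto
  show ?thesis unfolding first_visit_def * by (simp add: top_ereal_def)
qed

lemma last_visit_none:
  assumes "x 0 \<notin> S"
  shows "last_visit N S 0 x = - \<infinity>"
proof -
  have *: "{k. k < N \<and> k \<le> 0 \<and> x k \<in> S} = {}" using assms by auto
  show ?thesis unfolding last_visit_def * by (simp add: bot_ereal_def)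
qed

lemma first_visit_less_now:
  assumes "n < N" "x n \<in> B" "x n \<notin> A"
  shows "first_visit N B n x < first_visit N A n x"
proof -
  have "ereal (real n) < ereal (real (Suc n))" by simp
  also have "\<dots> \<le> first_visit N A n x"
    using first_visit_ge[of "Suc n" N A x] first_visit_later[of x n A N] assms by simp
  finally show ?thesis using first_visit_now[of n N x B] assms by simp
qed

lemma last_visit_less_now:
  assumes "n < N" "x n \<in> A" "x n \<notin> B"
  shows "last_visit N B n x < last_visit N A n x"
proof -
  have "last_visit N B n x < ereal (real n)"
  proof (cases n)
    case 0
    then show ?thesis using last_visit_none[of x B N] assms by simp
  next
    case (Suc m)
    have "last_visit N B n x \<le> ereal (real m)"
      using last_visit_earlier[of x m B N] last_visit_le[of N B m x] assms Suc by simp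
    also have "\<dots> < ereal (real n)" using Suc by simp
    finally show ?thesis .
  qed
  then show ?thesis using last_visit_now[of n N x A] assms by simp
qed

lemma not_first_visit_less_now:
  assumes "n < N" "x n \<in> A"
  shows "\<not> first_visit N B n x < first_visit N A n x"
  using first_visit_now[of n N x A] first_visit_ge[of n N B x] assms by (simp add: not_less)

lemma not_last_visit_less_now:
  assumes "n < N" "x n \<in> B"
  shows "\<not> last_visit N B n x < last_visit N A n x"
  using last_visit_now[of n N x B] last_visit_le[of N A n x] assms by (simp add: not_less)

section \<open>Weighted sums over paths\<close>

definition path_sum ::
  "nat \<Rightarrow> (nat \<Rightarrow> 's \<Rightarrow> 's \<Rightarrow> real) \<Rightarrow> nat \<Rightarrow> 's::finite \<Rightarrow> ((nat \<Rightarrow> 's) \<Rightarrow> bool) \<Rightarrow> real" where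
  "path_sum N P n i F =
     (\<Sum>x\<in>{x \<in> {n..<N} \<rightarrow>\<^sub>E UNIV. x n = i \<and> F x}. \<Prod>k\<in>{n..<N-1}. P k (x k) (x (Suc k)))"

lemma finite_paths: "finite {x \<in> {n..<N::nat} \<rightarrow>\<^sub>E (UNIV :: 's::finite set). F x}"
  by (rule finite_subset[of _ "{n..<N} \<rightarrow>\<^sub>E UNIV"]) (auto intro: finite_PiE)

lemma path_sum_cong:
  assumes "\<And>x. x n = i \<Longrightarrow> F x = G x"
  shows "path_sum N P n i F = path_sum N P n i G"
  unfolding path_sum_def using assms by (intro sum.cong) auto

lemma path_sum_False: "path_sum N P n i (\<lambda>x. False) = 0"
  unfolding path_sum_def by simp

text \<open>Removing the initial point is a bijection between the paths from time \<open>n\<close> that start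
  in \<open>i\<close> and all paths from time \<open>Suc n\<close>. The product defining the weight loses exactly
  its first factor.\<close>

lemma path_sum_step:
  assumes "Suc n < N" and FG: "\<And>y. F (y(n := i)) = G y"
    and G: "\<And>y z. G (y(n := z)) = G y"
  shows "path_sum N P n i F = (\<Sum>j\<in>UNIV. P n i j * path_sum N P (Suc n) j G)"
proof -
  let ?w = "\<lambda>m x. \<Prod>k\<in>{m..<N-1}. P k (x k) (x (Suc k))"
  let ?T = "{y \<in> {Suc n..<N} \<rightarrow>\<^sub>E UNIV. G y}"
  have "path_sum N P n i F = (\<Sum>y\<in>?T. P n i (y (Suc n)) * ?w (Suc n) y)"
    unfolding path_sum_def
  proof (rule sum.reindex_bij_witness[where i = "\<lambda>y. y(n := i)" and j = "\<lambda>x. x(n := undefined)"])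
    fix x assume x: "x \<in> {x \<in> {n..<N} \<rightarrow>\<^sub>E UNIV. x n = i \<and> F x}"
    then show "(x(n := undefined))(n := i) = x" by auto
    have "F (x(n := i))" using x by (metis (mono_tags, lifting) fun_upd_triv mem_Collect_eq)
    then show "x(n := undefined) \<in> ?T"
      using x FG G by (auto simp: PiE_def extensional_def)
    have "?w n x = P n (x n) (x (Suc n)) * ?w (Suc n) x"
      using assms(1) by (subst prod.atLeast_Suc_lessThan) auto
    also have "?w (Suc n) x = ?w (Suc n) (x(n := undefined))"
      by (rule prod.cong) auto
    finally show "P n i ((x(n := undefined)) (Suc n)) * ?w (Suc n) (x(n := undefined)) = ?w n x"
      using x by simp
  next
    fix y assume y: "y \<in> ?T"
    then show "(y(n := i))(n := undefined) = y" by (auto simp: PiE_def extensional_def)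
    show "y(n := i) \<in> {x \<in> {n..<N} \<rightarrow>\<^sub>E UNIV. x n = i \<and> F x}"
      using y FG assms(1) by (auto simp: PiE_def extensional_def)
  qed
  also have "\<dots> = (\<Sum>j\<in>UNIV. \<Sum>y\<in>{y \<in> ?T. y (Suc n) = j}. P n i (y (Suc n)) * ?w (Suc n) y)"
    by (rule sum.group[symmetric]) (auto intro: finite_paths)
  also have "\<dots> = (\<Sum>j\<in>UNIV. P n i j * path_sum N P (Suc n) j G)"
    unfolding path_sum_def sum_distrib_left by (intro sum.cong) auto
  finally show ?thesis .
qed

lemma path_sum_total:
  fixes P :: "nat \<Rightarrow> 's::finite \<Rightarrow> 's \<Rightarrow> real"
  assumes "\<forall>n. Suc n < N \<longrightarrow> row_stochastic (P n)" "n < N"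
  shows "path_sum N P n i (\<lambda>x. True) = 1"
proof -
  have "n \<le> N - 1" using assms(2) by simp
  then have "\<forall>i. path_sum N P n i (\<lambda>x. True) = 1"
  proof (induction rule: inc_induct)
    case base
    have "{x \<in> {N - 1..<N} \<rightarrow>\<^sub>E UNIV. x (N - 1) = i} = {(\<lambda>_. undefined)(N - 1 := i)}" for i :: 's
    proof -
      have *: "{N - 1..<N} = {N - 1}" using assms(2) by auto
      show ?thesis unfolding * by (auto simp: PiE_def extensional_def)
    qed
    then show ?case unfolding path_sum_def by (simp del: One_nat_def)
  next
    case (step m)
    then have "Suc m < N" by simp
    then show ?case
      using step.IH assms(1) by (simp add: path_sum_step[where G = "\<lambda>x. True"] row_stochastic_def)
  qed
  then show ?thesis by blast
qed

lemma prob_started_chain: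
  assumes "\<forall>n. Suc n < N \<longrightarrow> row_stochastic (P n)"
  shows "\<P>(x in started_chain N P n i. F x) = path_sum N P n i F"
proof -
  let ?S = "{x \<in> {n..<N} \<rightarrow>\<^sub>E UNIV. x n = i}"
  let ?w = "\<lambda>x. \<Prod>k\<in>{n..<N-1}. P k (x k) (x (Suc k))"
  have w: "0 \<le> ?w x" for x
    using assms by (intro prod_nonneg) (auto simp: row_stochastic_def)
  have sp: "{x \<in> space (started_chain N P n i). F x} = {x \<in> ?S. F x}"
    by (simp add: started_chain_def space_point_measure)
  have "emeasure (started_chain N P n i) {x \<in> ?S. F x} = (\<Sum>x\<in>{x \<in> ?S. F x}. ennreal (?w x))"
    unfolding started_chain_def
    by (rule emeasure_point_measure_finite) (auto intro: finite_paths)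
  also have "\<dots> = ennreal (\<Sum>x\<in>{x \<in> ?S. F x}. ?w x)"
    using w by (intro sum_ennreal) auto
  finally show ?thesis
    unfolding sp path_sum_def measure_def using w
    by (simp add: sum_nonneg conj_assoc)
qed

section \<open>The Markov property for windows of time\<close>

lemma (in prob_space) prob_split_finite:
  assumes "finite S" "\<And>\<omega>. \<omega> \<in> space M \<Longrightarrow> Q \<omega> \<Longrightarrow> Y \<omega> \<in> S"
    and "\<And>y. y \<in> S \<Longrightarrow> {\<omega> \<in> space M. Y \<omega> = y \<and> Q \<omega>} \<in> events"
  shows "\<P>(\<omega> in M. Q \<omega>) = (\<Sum>y\<in>S. \<P>(\<omega> in M. Y \<omega> = y \<and> Q \<omega>))"
proof -
  have "{\<omega> \<in> space M. Q \<omega>} = (\<Union>y\<in>S. {\<omega> \<in> space M. Y \<omega> = y \<and> Q \<omega>})"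
    using assms(2) by auto
  then show ?thesis
    using assms by (auto intro!: finite_measure_finite_Union simp: disjoint_family_on_def)
qed

lemma markov_chain_prob_space: "markov_chain M N P \<mu> X \<Longrightarrow> prob_space M"
  and markov_chain_row_stochastic:
    "markov_chain M N P \<mu> X \<Longrightarrow> \<forall>n. Suc n < N \<longrightarrow> row_stochastic (P n)"
  unfolding markov_chain_def by blast+

lemma markov_chain_state_event:
  assumes "markov_chain M N P \<mu> X" "n < N"
  shows "{\<omega> \<in> space M. X n \<omega> = i} \<in> sets M"
proof -
  have "X n \<in> measurable M (count_space UNIV)"
    using assms unfolding markov_chain_def by blast
  from measurable_sets[OF this, of "{i}"] show ?thesis
    by (auto simp: vimage_def Int_def conj_commute)
qed

lemma markov_chain_cylinder_event:
  assumes "markov_chain M N P \<mu> X" "I \<subseteq> {..<N}"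
  shows "{\<omega> \<in> space M. \<forall>k\<in>I. X k \<omega> = x k} \<in> sets M"
  using assms finite_subset[OF assms(2)]
  by (intro sets.sets_Collect_finite_All) (auto intro: markov_chain_state_event)

text \<open>This reduces windowed events to cylinders, on which the Markov property gives explicit
  products. Having \<open>Q\<close> arbitrary leaves room for a condition on the time after the
  window.\<close>

lemma prob_split_window:
  assumes mc: "markov_chain M N P \<mu> X" and I: "I \<subseteq> {..<N}" and F: "depends_on I F"
    and Q: "{\<omega> \<in> space M. Q \<omega>} \<in> sets M"
  shows "\<P>(\<omega> in M. F (\<lambda>k. X k \<omega>) \<and> Q \<omega>) =
    (\<Sum>x\<in>{x \<in> I \<rightarrow>\<^sub>E UNIV. F x}. \<P>(\<omega> in M. (\<forall>k\<in>I. X k \<omega> = x k) \<and> Q \<omega>))"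
proof -
  interpret prob_space M using mc by (rule markov_chain_prob_space)
  have fin: "finite I" using I finite_subset by blast
  let ?S = "{x \<in> I \<rightarrow>\<^sub>E UNIV. F x}" and ?Y = "\<lambda>\<omega>. restrict (\<lambda>k. X k \<omega>) I"
  have F_Y: "F (?Y \<omega>) = F (\<lambda>k. X k \<omega>)" for \<omega> by (rule depends_onD[OF F]) simp
  have eq: "?Y \<omega> = x \<and> F (\<lambda>k. X k \<omega>) \<and> Q \<omega> \<longleftrightarrow> (\<forall>k\<in>I. X k \<omega> = x k) \<and> Q \<omega>"
    if "x \<in> ?S" for x \<omega>
  proof -
    have "?Y \<omega> = x \<longleftrightarrow> (\<forall>k\<in>I. X k \<omega> = x k)"
      using that by (auto simp: PiE_def extensional_def fun_eq_iff restrict_def)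
    moreover have "?Y \<omega> = x \<Longrightarrow> F (\<lambda>k. X k \<omega>)" using that F_Y by auto
    ultimately show ?thesis by blast
  qed
  have "\<P>(\<omega> in M. F (\<lambda>k. X k \<omega>) \<and> Q \<omega>) =
      (\<Sum>x\<in>?S. \<P>(\<omega> in M. ?Y \<omega> = x \<and> F (\<lambda>k. X k \<omega>) \<and> Q \<omega>))"
  proof (rule prob_split_finite)
    show "finite ?S" using fin by (auto intro: finite_subset[OF _ finite_PiE[of I "\<lambda>_. UNIV"]])
    show "?Y \<omega> \<in> ?S" if "F (\<lambda>k. X k \<omega>) \<and> Q \<omega>" for \<omega> using that F_Y by auto
    show "{\<omega> \<in> space M. ?Y \<omega> = x \<and> F (\<lambda>k. X k \<omega>) \<and> Q \<omega>} \<in> events" if "x \<in> ?S" for x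
      unfolding eq[OF that] by (rule sets.sets_Collect_conj[OF Q markov_chain_cylinder_event[OF mc I]])
  qed
  also have "\<dots> = (\<Sum>x\<in>?S. \<P>(\<omega> in M. (\<forall>k\<in>I. X k \<omega> = x k) \<and> Q \<omega>))"
    by (intro sum.cong refl) (simp add: eq)
  finally show ?thesis .
qed

lemma depends_on_event:
  fixes X :: "nat \<Rightarrow> 'w \<Rightarrow> 's::finite"
  assumes mc: "markov_chain M N P \<mu> X" and I: "I \<subseteq> {..<N}" and F: "depends_on I F"
  shows "{\<omega> \<in> space M. F (\<lambda>k. X k \<omega>)} \<in> sets M"
proof -
  have "finite I" using I finite_subset by blast
  then have fin: "finite {x \<in> I \<rightarrow>\<^sub>E (UNIV :: 's set). F x}"
    by (auto intro: finite_subset[OF _ finite_PiE[of I "\<lambda>_. UNIV"]])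
  have "{\<omega> \<in> space M. F (\<lambda>k. X k \<omega>)} =
      (\<Union>x\<in>{x \<in> I \<rightarrow>\<^sub>E UNIV. F x}. {\<omega> \<in> space M. \<forall>k\<in>I. X k \<omega> = x k})" (is "?L = ?R")
  proof
    show "?L \<subseteq> ?R"
    proof
      fix \<omega> assume "\<omega> \<in> ?L"
      moreover have "F (restrict (\<lambda>k. X k \<omega>) I) = F (\<lambda>k. X k \<omega>)" by (rule depends_onD[OF F]) simp
      ultimately show "\<omega> \<in> ?R" by (intro UN_I[of "restrict (\<lambda>k. X k \<omega>) I"]) auto
    qed
    show "?R \<subseteq> ?L" using depends_onD[OF F] by fastforce
  qed
  then show ?thesis
    using fin markov_chain_cylinder_event[OF mc I] by auto
qed

text \<open>The defining property in product form, which also covers histories of probability zero: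
  both sides then vanish.\<close>

lemma prob_history_next:
  assumes mc: "markov_chain M N P \<mu> X" and n: "Suc n < N"
  shows "\<P>(\<omega> in M. (\<forall>k\<in>{..n}. X k \<omega> = x k) \<and> X (Suc n) \<omega> = j) =
    \<P>(\<omega> in M. \<forall>k\<in>{..n}. X k \<omega> = x k) * P n (x n) j"
proof -
  interpret prob_space M using mc by (rule markov_chain_prob_space)
  let ?h = "\<P>(\<omega> in M. \<forall>k\<le>n. X k \<omega> = x k)"
  have ev: "{\<omega> \<in> space M. \<forall>k\<in>{..n}. X k \<omega> = x k} \<in> events"
    using n by (intro markov_chain_cylinder_event[OF mc]) auto
  show ?thesis
  proof (cases "?h > 0")
    case True
    \<comment> \<open>The Markov property reads the next state off the sequence, hence the update.\<close>
    let ?x = "x(Suc n := j)"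
    have h: "(\<forall>k\<le>n. X k \<omega> = ?x k) \<longleftrightarrow> (\<forall>k\<le>n. X k \<omega> = x k)" for \<omega> by auto
    have "\<forall>x. \<P>(\<omega> in M. \<forall>k\<le>n. X k \<omega> = x k) > 0 \<longrightarrow>
        \<P>(\<omega> in M. X (Suc n) \<omega> = x (Suc n) \<bar> \<forall>k\<le>n. X k \<omega> = x k) = P n (x n) (x (Suc n))"
      using mc n unfolding markov_chain_def by blast
    from this[rule_format, of ?x] True
    have "\<P>(\<omega> in M. X (Suc n) \<omega> = j \<bar> \<forall>k\<le>n. X k \<omega> = x k) = P n (x n) j"
      unfolding h by simp
    then show ?thesis using True by (simp add: cond_prob_def field_simps conj_commute Ball_def)
  next
    case False
    then have z: "\<P>(\<omega> in M. \<forall>k\<in>{..n}. X k \<omega> = x k) = 0"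
      by (simp add: not_less measure_le_0_iff Ball_def)
    have "\<P>(\<omega> in M. (\<forall>k\<in>{..n}. X k \<omega> = x k) \<and> X (Suc n) \<omega> = j) \<le>
        \<P>(\<omega> in M. \<forall>k\<in>{..n}. X k \<omega> = x k)"
      by (rule finite_measure_mono[OF _ ev]) auto
    then show ?thesis using z by (simp add: measure_le_0_iff)
  qed
qed

text \<open>Summing over all histories in \<open>F\<close> that end in \<open>i\<close>: given the present state, the
  next one is independent of any event of the past.\<close>

lemma prob_past_next:
  assumes mc: "markov_chain M N P \<mu> X" and n: "Suc n < N" and F: "depends_on {..n} F"
  shows "\<P>(\<omega> in M. (F (\<lambda>k. X k \<omega>) \<and> X n \<omega> = i) \<and> X (Suc n) \<omega> = j) =
    \<P>(\<omega> in M. F (\<lambda>k. X k \<omega>) \<and> X n \<omega> = i) * P n i j"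
proof -
  let ?F = "\<lambda>x. F x \<and> x n = i"
  have F': "depends_on {..n} ?F" using F unfolding depends_on_def by (metis atMost_iff order_refl)
  have I: "{..n} \<subseteq> {..<N}" using n by auto
  have "\<P>(\<omega> in M. ?F (\<lambda>k. X k \<omega>) \<and> X (Suc n) \<omega> = j) =
      (\<Sum>x\<in>{x \<in> {..n} \<rightarrow>\<^sub>E UNIV. ?F x}. \<P>(\<omega> in M. \<forall>k\<in>{..n}. X k \<omega> = x k) * P n i j)"
    unfolding prob_split_window[OF mc I F' markov_chain_state_event[OF mc n]]
    by (intro sum.cong) (auto simp: prob_history_next[OF mc n])
  also have "\<dots> = \<P>(\<omega> in M. ?F (\<lambda>k. X k \<omega>)) * P n i j"
    using prob_split_window[OF mc I F', of "\<lambda>_. True"] by (simp add: sum_distrib_right)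
  finally show ?thesis .
qed

lemma prob_window_path:
  assumes mc: "markov_chain M N P \<mu> X" and "n \<le> m" "m < N"
  shows "\<P>(\<omega> in M. \<forall>k\<in>{n..m}. X k \<omega> = x k) =
    state_prob M X n (x n) * (\<Prod>k\<in>{n..<m}. P k (x k) (x (Suc k)))"
  using assms(2,3)
proof (induction m rule: dec_induct)
  case base
  then show ?case by (simp add: state_prob_def)
next
  case (step m)
  let ?F = "\<lambda>y. \<forall>k\<in>{n..m}. y k = x k"
  have F: "depends_on {..m} ?F" unfolding depends_on_def by auto
  have "(\<forall>k\<in>{n..Suc m}. X k \<omega> = x k) \<longleftrightarrow>
      (?F (\<lambda>k. X k \<omega>) \<and> X m \<omega> = x m) \<and> X (Suc m) \<omega> = x (Suc m)" for \<omega>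
    using step.hyps by (auto simp: le_Suc_eq)
  moreover have "?F (\<lambda>k. X k \<omega>) \<and> X m \<omega> = x m \<longleftrightarrow> ?F (\<lambda>k. X k \<omega>)" for \<omega>
    using step.hyps by auto
  ultimately have "\<P>(\<omega> in M. \<forall>k\<in>{n..Suc m}. X k \<omega> = x k) =
      \<P>(\<omega> in M. ?F (\<lambda>k. X k \<omega>)) * P m (x m) (x (Suc m))"
    using prob_past_next[OF mc step.prems F, of "x m" "x (Suc m)"] by simp
  then show ?case using step by (simp add: prod.atLeastLessThan_Suc)
qed

text \<open>The law of the chain from time \<open>n\<close> on is that of the started chain, whenever the
  starting state has positive probability.\<close>

lemma prob_future:
  assumes mc: "markov_chain M N P \<mu> X" and n: "n < N" and F: "depends_on {n..<N} F"
  shows "\<P>(\<omega> in M. F (\<lambda>k. X k \<omega>) \<and> X n \<omega> = i) = state_prob M X n i * path_sum N P n i F"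
proof -
  let ?F = "\<lambda>x. x n = i \<and> F x"
  have F': "depends_on {n..<N} ?F"
    using F n unfolding depends_on_def by (metis atLeastLessThan_iff order_refl)
  have I: "{n..<N} \<subseteq> {..<N}" and I': "{n..<N} = {n..N - 1}" using n by auto
  have "\<P>(\<omega> in M. F (\<lambda>k. X k \<omega>) \<and> X n \<omega> = i) = \<P>(\<omega> in M. ?F (\<lambda>k. X k \<omega>))"
    by (simp add: conj_commute)
  also have "\<dots> = (\<Sum>x\<in>{x \<in> {n..<N} \<rightarrow>\<^sub>E UNIV. ?F x}. \<P>(\<omega> in M. \<forall>k\<in>{n..<N}. X k \<omega> = x k))"
    using prob_split_window[OF mc I F', of "\<lambda>_. True"] by simp
  also have "\<dots> = (\<Sum>x\<in>{x \<in> {n..<N} \<rightarrow>\<^sub>E UNIV. ?F x}.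
      state_prob M X n i * (\<Prod>k\<in>{n..<N-1}. P k (x k) (x (Suc k))))"
    using n by (intro sum.cong refl) (auto simp: I' prob_window_path[OF mc])
  finally show ?thesis by (simp add: path_sum_def sum_distrib_left)
qed

section \<open>Forward committor\<close>

lemma forward_committor_eq_path_sum:
  assumes mc: "markov_chain M N P \<mu> X" and n: "n < N"
  shows "forward_committor M N P X A B n i =
    path_sum N P n i (\<lambda>x. first_visit N B n x < first_visit N A n x)"
proof (cases "state_prob M X n i > 0")
  case True
  then show ?thesis
    unfolding forward_committor_def cond_prob_def
    using prob_future[OF mc n depends_on_first_visit[of n N B A], of i]
    by (simp add: state_prob_def)
next
  case False
  then show ?thesis
    unfolding forward_committor_def
    by (simp add: prob_started_chain[OF markov_chain_row_stochastic[OF mc]])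
qed

lemma forward_committor_A:
  assumes "markov_chain M N P \<mu> X" "n < N" "i \<in> A"
  shows "forward_committor M N P X A B n i = 0"
proof -
  have "path_sum N P n i (\<lambda>x. first_visit N B n x < first_visit N A n x) =
      path_sum N P n i (\<lambda>x. False)"
    using assms by (intro path_sum_cong) (simp add: not_first_visit_less_now)
  then show ?thesis
    by (simp add: forward_committor_eq_path_sum[OF assms(1,2)] path_sum_False)
qed

lemma forward_committor_B:
  assumes "markov_chain M N P \<mu> X" "n < N" "i \<in> B" "A \<inter> B = {}"
  shows "forward_committor M N P X A B n i = 1"
proof -
  have "i \<notin> A" using assms by auto
  then have "path_sum N P n i (\<lambda>x. first_visit N B n x < first_visit N A n x) =
      path_sum N P n i (\<lambda>x. True)"
    using assms by (intro path_sum_cong) (simp add: first_visit_less_now)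
  then show ?thesis
    using path_sum_total[OF markov_chain_row_stochastic[OF assms(1)] assms(2)]
    by (simp add: forward_committor_eq_path_sum[OF assms(1,2)])
qed

lemma forward_committor_step:
  assumes mc: "markov_chain M N P \<mu> X" and n: "Suc n < N" and i: "i \<notin> A \<union> B"
  shows "forward_committor M N P X A B n i =
    (\<Sum>j\<in>UNIV. P n i j * forward_committor M N P X A B (Suc n) j)"
proof -
  let ?F = "\<lambda>n x. first_visit N B n x < first_visit N A n x"
  have G: "?F (Suc n) (y(n := z)) = ?F (Suc n) y" for y z
    by (rule depends_onD[OF depends_on_first_visit]) simp
  have "?F n (y(n := i)) = ?F (Suc n) y" for y
    using i first_visit_later[of "y(n := i)" n A N] first_visit_later[of "y(n := i)" n B N] G[of y i]
    by simp
  from path_sum_step[OF n this G, of P] show ?thesis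
    using n by (simp add: forward_committor_eq_path_sum[OF mc])
qed

lemma forward_committor_final:
  assumes mc: "markov_chain M N P \<mu> X" and "N \<ge> 1" "A \<inter> B = {}"
  shows "forward_committor M N P X A B (N - 1) i = indicator B i"
proof -
  have N: "N - 1 < N" "Suc (N - 1) = N" using assms(2) by auto
  consider "i \<in> A" | "i \<in> B" | "i \<notin> A \<union> B" by blast
  then show ?thesis
  proof cases
    case 1
    then show ?thesis using forward_committor_A[OF mc N(1), of i A B] assms(3) by (auto simp: indicator_def)
  next
    case 2
    then show ?thesis using forward_committor_B[OF mc N(1) _ assms(3)] by simp
  next
    case 3
    have "path_sum N P (N - 1) i (\<lambda>x. first_visit N B (N - 1) x < first_visit N A (N - 1) x) =
        path_sum N P (N - 1) i (\<lambda>x. False)"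
      using 3 first_visit_later[of _ "N - 1" B N, unfolded N(2)]
      by (intro path_sum_cong) (simp add: first_visit_none)
    then show ?thesis
      using 3 by (simp add: forward_committor_eq_path_sum[OF mc N(1)] path_sum_False del: One_nat_def)
  qed
qed

section \<open>Backward committor\<close>

lemma cond_prob_state_certain:
  assumes "0 < state_prob M X n i" "\<And>\<omega>. X n \<omega> = i \<Longrightarrow> F \<omega>"
  shows "\<P>(\<omega> in M. F \<omega> \<bar> X n \<omega> = i) = 1"
proof -
  have "{\<omega> \<in> space M. F \<omega> \<and> X n \<omega> = i} = {\<omega> \<in> space M. X n \<omega> = i}" using assms(2) by auto
  then show ?thesis using assms(1) by (simp add: cond_prob_def state_prob_def)
qed

lemma cond_prob_state_impossible:
  assumes "\<And>\<omega>. X n \<omega> = i \<Longrightarrow> \<not> F \<omega>"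
  shows "\<P>(\<omega> in M. F \<omega> \<bar> X n \<omega> = i) = 0"
proof -
  have *: "{\<omega> \<in> space M. F \<omega> \<and> X n \<omega> = i} = {}" using assms by auto
  show ?thesis unfolding cond_prob_def * by simp
qed

lemma backward_committor_A:
  assumes "n < N" "i \<in> A" "A \<inter> B = {}"
  shows "backward_committor M N X A B n i = 1"
proof -
  have "i \<notin> B" using assms by auto
  then show ?thesis
    unfolding backward_committor_def using assms
    by (auto intro!: cond_prob_state_certain last_visit_less_now)
qed

lemma backward_committor_B:
  assumes "n < N" "i \<in> B" "A \<inter> B = {}"
  shows "backward_committor M N X A B n i = 0"
proof -
  have "i \<notin> A" using assms by auto
  then show ?thesis
    unfolding backward_committor_def using assms not_last_visit_less_now[of n N _ B A]
    by (auto intro!: cond_prob_state_impossible)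
qed

lemma backward_committor_initial:
  assumes "N \<ge> 1" "A \<inter> B = {}"
  shows "backward_committor M N X A B 0 i = indicator A i"
proof -
  have N: "0 < N" using assms(1) by simp
  show ?thesis
  proof (cases "i \<in> A \<union> B")
    case True
    then show ?thesis
      using backward_committor_A[OF N _ assms(2)] backward_committor_B[OF N _ assms(2)] assms(2)
      by (auto simp: indicator_def)
  next
    case False
    then show ?thesis
      unfolding backward_committor_def
      by (auto intro!: cond_prob_state_impossible simp: last_visit_none)
  qed
qed

text \<open>The joint probability of the event of the past, \<open>X n = j\<close> and \<open>X (Suc n) = i\<close> is
  \<open>q j * \<lambda> j * P n j i\<close>, with \<open>\<lambda>\<close> the distribution and \<open>q\<close> the
  backward committor at time \<open>n\<close>; division by the probability of \<open>X (Suc n) = i\<close> turns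
  \<open>\<lambda> j * P n j i\<close> into the backward transition probability.\<close>

lemma backward_committor_step:
  assumes mc: "markov_chain M N P \<mu> X" and n: "Suc n < N" and i: "i \<notin> A \<union> B"
  shows "backward_committor M N X A B (Suc n) i =
    (\<Sum>j\<in>UNIV. backward_trans M X (Suc n) i j * backward_committor M N X A B n j)"
proof (cases "state_prob M X (Suc n) i > 0")
  case False
  then show ?thesis using i by (simp add: backward_committor_def backward_trans_def)
next
  case True
  interpret prob_space M using mc by (rule markov_chain_prob_space)
  let ?E = "\<lambda>n \<omega>. last_visit N B n (\<lambda>k. X k \<omega>) < last_visit N A n (\<lambda>k. X k \<omega>)"
  let ?l = "state_prob M X" and ?q = "backward_committor M N X A B n"
  note past = prob_past_next[OF mc n depends_on_last_visit[of n N B A]]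
  have I: "{..n} \<subseteq> {..<N}" using n by auto
  have state: "{\<omega> \<in> space M. X m \<omega> = j} \<in> events" if "m \<le> Suc n" for m j
    using markov_chain_state_event[OF mc] that n by auto
  have E_event: "{\<omega> \<in> space M. ?E n \<omega>} \<in> events"
    using depends_on_event[OF mc I depends_on_last_visit[of n N B A]] .
  have q: "\<P>(\<omega> in M. ?E n \<omega> \<and> X n \<omega> = j) = ?l n j * ?q j" for j
  proof (cases "?l n j > 0")
    case True
    then show ?thesis by (simp add: backward_committor_def cond_prob_def state_prob_def)
  next
    case False
    have "\<P>(\<omega> in M. ?E n \<omega> \<and> X n \<omega> = j) \<le> ?l n j"
      unfolding state_prob_def by (rule finite_measure_mono) (auto intro: state)
    moreover have "?l n j = 0" using False by (simp add: state_prob_def not_less measure_le_0_iff)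
    ultimately show ?thesis by (simp add: measure_le_0_iff)
  qed
  have trans: "backward_trans M X (Suc n) i j = ?l n j * P n j i / ?l (Suc n) i" for j
    using True prob_past_next[OF mc n, of "\<lambda>_. True" j i]
    by (simp add: backward_trans_def cond_prob_def state_prob_def depends_on_def)
  have "\<P>(\<omega> in M. ?E (Suc n) \<omega> \<and> X (Suc n) \<omega> = i) = \<P>(\<omega> in M. ?E n \<omega> \<and> X (Suc n) \<omega> = i)"
    using i by (intro arg_cong[where f = "measure M"]) (auto simp: last_visit_earlier)
  also have "\<dots> = (\<Sum>j\<in>UNIV. \<P>(\<omega> in M. X n \<omega> = j \<and> ?E n \<omega> \<and> X (Suc n) \<omega> = i))"
    by (rule prob_split_finite)
       (auto intro!: sets.sets_Collect_conj state E_event)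
  also have "\<dots> = (\<Sum>j\<in>UNIV. \<P>(\<omega> in M. (?E n \<omega> \<and> X n \<omega> = j) \<and> X (Suc n) \<omega> = i))"
    by (simp add: conj_ac)
  also have "\<dots> = (\<Sum>j\<in>UNIV. ?l n j * ?q j * P n j i)"
    by (simp only: past q)
  finally have "backward_committor M N X A B (Suc n) i =
      (\<Sum>j\<in>UNIV. ?l n j * ?q j * P n j i) / ?l (Suc n) i"
    using True by (simp add: backward_committor_def cond_prob_def state_prob_def)
  then show ?thesis by (simp add: trans sum_divide_distrib mult_ac)
qed

section \<open>The committor equations\<close>

theorem theorem5p2:
  fixes M :: "'w measure"
    and N :: nat
    and P :: "nat \<Rightarrow> 's::finite \<Rightarrow> 's \<Rightarrow> real"
    and \<mu> :: "'s \<Rightarrow> real"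
    and X :: "nat \<Rightarrow> 'w \<Rightarrow> 's"
    and A B C :: "'s set"
  assumes "N \<ge> 1"
    and "markov_chain M N P \<mu> X"
    and "A \<noteq> {}" and "B \<noteq> {}" and "A \<inter> B = {}"
    and "C = - (A \<union> B)" and "C \<noteq> {}"
  shows "(\<forall>n. Suc n < N \<longrightarrow>
            (\<forall>i\<in>C. forward_committor M N P X A B n i =
                (\<Sum>j\<in>UNIV. P n i j * forward_committor M N P X A B (Suc n) j)) \<and>
            (\<forall>i\<in>A. forward_committor M N P X A B n i = 0) \<and>
            (\<forall>i\<in>B. forward_committor M N P X A B n i = 1)) \<and>
         (\<forall>i. forward_committor M N P X A B (N - 1) i = indicator B i) \<and>
         (\<forall>n. 1 \<le> n \<and> n < N \<longrightarrow>
            (\<forall>i\<in>C. backward_committor M N X A B n i =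
                (\<Sum>j\<in>UNIV. backward_trans M X n i j * backward_committor M N X A B (n - 1) j)) \<and>
            (\<forall>i\<in>A. backward_committor M N X A B n i = 1) \<and>
            (\<forall>i\<in>B. backward_committor M N X A B n i = 0)) \<and>
         (\<forall>i. backward_committor M N X A B 0 i = indicator A i)"
proof (intro conjI allI impI ballI)
  note mc = assms(2)
  fix n i assume n: "Suc n < N"
  then have n': "n < N" by simp
  show "forward_committor M N P X A B n i =
      (\<Sum>j\<in>UNIV. P n i j * forward_committor M N P X A B (Suc n) j)" if "i \<in> C"
    using forward_committor_step[OF mc n, of i A B] that assms(6) by auto
  show "forward_committor M N P X A B n i = 0" if "i \<in> A"
    using forward_committor_A[OF mc n' that] .
  show "forward_committor M N P X A B n i = 1" if "i \<in> B"
    using forward_committor_B[OF mc n' that assms(5)] .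
next
  fix i
  show "forward_committor M N P X A B (N - 1) i = indicator B i"
    using forward_committor_final[OF assms(2,1,5)] .
  show "backward_committor M N X A B 0 i = indicator A i"
    using backward_committor_initial[OF assms(1,5)] .
next
  fix n i assume n: "1 \<le> n \<and> n < N"
  then obtain m where m: "n = Suc m" by (cases n) auto
  show "backward_committor M N X A B n i =
      (\<Sum>j\<in>UNIV. backward_trans M X n i j * backward_committor M N X A B (n - 1) j)" if "i \<in> C"
    using backward_committor_step[OF assms(2), of m i A B] that n m assms(6) by auto
  show "backward_committor M N X A B n i = 1" if "i \<in> A"
    using backward_committor_A[OF conjunct2[OF n] that assms(5)] .
  show "backward_committor M N X A B n i = 0" if "i \<in> B"
    using backward_committor_B[OF conjunct2[OF n] that assms(5)] .
qed

end
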